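(* (1) If $n\ge 4$ and $R\ge 1$ are integers such that $R\not\longrightarrow (n-1)^2_2$, then $\mathrm{L}^{(2)}(n)>2^{R}$. (2) If $n\ge k\ge 3$ are integers, then $\mathrm{L}^{(k)}(4n+k)>2^{\mathrm{L}^{(k-1)}(n)-1}$.
   Context: For a natural number $N$ let $[N]=\{1,\dots,N\}$, and for a set $X$ let $X^{(k)}$ be the set of all $k$-element subsets of $X$. The negative partition relation $R\not\longrightarrow (q)^2_2$ means that there exists a colouring of $[R]^{(2)}$ with $2$ colours for which there is no set $X\subseteq[R]$ of size $q$ with $X^{(2)}$ monochromatic. An ordering means a (strict) linear ordering. For a set $X$ of integers, an ordering $(X^{(k)},\prec)$ is canonical if for any two (finite) sets $A,B\subseteq X$ of the same size the order-preserving map from $A$ to $B$ (with respect to the usual order of the integers) induces an order-preserving map from $(A^{(k)},\prec)$ to $(B^{(k)},\prec)$. For positive integers $k,n$, $\mathrm{L}^{(k)}(n)$ denotes the least integer such that for every $N\ge \mathrm{L}^{(k)}(n)$ and every ordering $([N]^{(k)},\prec)$ there is a set $X\subseteq[N]$ of size $n$ such that $(X^{(k)},\prec)$ is canonical. (Such an integer exists by a theorem of Leeb.) *)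

theory Defs
  imports "HOL-Library.Ramsey"
begin

text \<open>
  Orderings are strict linear orders in the sense of \<^const>\<open>strict_linear_order_on\<close>; the relation
  may contain pairs outside the ordered set, but \<open>canonical k X r\<close> only inspects \<open>r\<close> on the
  \<open>k\<close>-subsets of \<open>X\<close>. For finite \<open>A\<close> and \<open>B\<close> of the same size exactly one \<open>f\<close> (up to its values
  outside \<open>A\<close>) satisfies the premises below, namely the order-preserving map from \<open>A\<close> to \<open>B\<close>.
\<close>

definition canonical :: "nat \<Rightarrow> 'a::linorder set \<Rightarrow> 'a set rel \<Rightarrow> bool" where
  "canonical k X r \<longleftrightarrow>
     (\<forall>A B. A \<subseteq> X \<longrightarrow> B \<subseteq> X \<longrightarrow> finite A \<longrightarrow> finite B \<longrightarrow> card A = card B \<longrightarrow>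
       (\<forall>f. bij_betw f A B \<longrightarrow> strict_mono_on A f \<longrightarrow>
         monotone_on (nsets A k) (\<lambda>S T. (S, T) \<in> r) (\<lambda>S T. (S, T) \<in> r) ((`) f)))"

text \<open>
  Leeb's theorem says that the set whose least element is taken here is nonempty for
  positive \<open>k\<close> and \<open>n\<close>.
\<close>

definition leeb_number :: "nat \<Rightarrow> nat \<Rightarrow> nat" where
  "leeb_number k n =
     (LEAST M. \<forall>N\<ge>M. \<forall>r. strict_linear_order_on (nsets {1..N} k) r \<longrightarrow>
        (\<exists>X \<in> nsets {1..N} n. canonical k X r))"

end

theory Submission
  imports Defs "HOL-Library.Product_Lexorder" "HOL-Library.Nat_Bijection"
begin

text \<open>
  Both bounds come from the stepping-up construction of Erdos and Hajnal. View \<open>{1..2^R}\<close> as the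
  leaves of the binary tree of height \<open>R\<close> in left-to-right order, and let \<open>branch x y\<close> be the level
  at which \<open>x\<close> and \<open>y\<close> separate. Leaves \<open>x\<^sub>0 < \<dots> < x\<^sub>m\<close> whose consecutive branching levels are
  monotone form a comb, and the branching levels of any of its subsets are determined by the
  \<open>m\<close>-element set of levels of the comb.

  For pairs, order \<open>{x, y}\<close> first by \<open>i = branch x y\<close>, then by \<open>x\<close> and \<open>y\<close> in the lexicographic order
  in which the nodes at level \<open>j\<close> are flipped if \<open>\<phi> {i, j} = 1\<close>. A canonical set is a comb, because
  \<open>{x\<^sub>i, x\<^sub>i\<^sub>+\<^sub>1}\<close> and \<open>{x\<^sub>i\<^sub>+\<^sub>1, x\<^sub>i\<^sub>+\<^sub>2}\<close> compare the same way for all \<open>i\<close>, and comparing pairs with the same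
  branching level shows that \<open>\<phi>\<close> is constant on its levels.

  For \<open>k \<ge> 3\<close>, order \<open>k\<close>-sets first by whether the first two branching levels rise, then by their
  sets of branching levels, using a bad ordering of the \<open>(k - 1)\<close>-sets of levels. In a canonical
  set the blocks of \<open>k\<close> consecutive elements form a chain, so rising and falling change at most once,
  whence a long part is a comb. Its levels would be canonical for the bad ordering.

  That \<open>leeb_number\<close> is the minimum of a nonempty set follows from Ramsey's theorem: colour each
  \<open>2k\<close>-set by the relation induced on the index sets of its \<open>k\<close>-subsets, and drop the last \<open>2k\<close>
  elements of a homogeneous set, which serve to extend \<open>S \<union> T\<close> to a \<open>2k\<close>-set.
\<close>

section \<open>Leeb's theorem from Ramsey's theorem\<close>

lemma canonical_image:
  assumes "canonical k X r" "A \<subseteq> X" "finite A" "strict_mono_on A f" "f ` A \<subseteq> X"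
    and "S \<in> nsets A k" "T \<in> nsets A k" "(S, T) \<in> r"
  shows "(f ` S, f ` T) \<in> r"
proof -
  have inj: "inj_on f A"
    using assms(4) by (rule strict_mono_on_imp_inj_on)
  have "monotone_on (nsets A k) (\<lambda>S T. (S, T) \<in> r) (\<lambda>S T. (S, T) \<in> r) ((`) f)"
    using assms(1-5) inj card_image[OF inj] inj_on_imp_bij_betw[OF inj]
    unfolding canonical_def by (metis finite_imageI)
  then show ?thesis
    using assms(6-8) by (auto simp: monotone_on_def)
qed

lemma sorted_list_of_set_image:
  assumes "finite U" "strict_mono_on U f"
  shows "sorted_list_of_set (f ` U) = map f (sorted_list_of_set U)"
proof -
  have "sorted_wrt (\<lambda>x y. f x < f y) (sorted_list_of_set U)"
    using assms by (intro sorted_wrt_mono_rel[OF _ strict_sorted_list_of_set])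
      (auto simp: strict_mono_on_def)
  then have "sorted_wrt (<) (map f (sorted_list_of_set U))"
    by (simp add: sorted_wrt_map)
  moreover have "card (f ` U) = card U"
    using assms(2) by (simp add: card_image strict_mono_on_imp_inj_on)
  ultimately show ?thesis
    using assms(1) by (intro sorted_list_of_set_unique[THEN iffD1]) auto
qed

lemma nsets_of_enumeration:
  assumes "finite U" "card U = m" "S \<in> nsets U k"
  obtains P where "P \<in> nsets {..<m} k" "(\<lambda>i. sorted_list_of_set U ! i) ` P = S"
proof -
  let ?e = "\<lambda>i. sorted_list_of_set U ! i"
  have bij: "bij_betw ?e {..<m} U"
    using bij_betw_nth[of "sorted_list_of_set U" "{..<m}" U] assms by simp
  then have "(\<lambda>X. ?e ` X) ` nsets {..<m} k = nsets U k"
    by (intro bij_betw_imp_surj_on bij_betw_nsets)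
  then show ?thesis
    using assms(3) that by (metis (no_types, lifting) imageE)
qed

lemma leeb_theorem:
  "\<exists>M::nat. \<forall>N\<ge>M. \<forall>r. \<exists>X \<in> nsets {1..N} n. canonical k X r"
proof -
  define pats where "pats = Pow (nsets {..<2 * k} k \<times> nsets {..<2 * k} k)"
  have "finite pats"
    unfolding pats_def by (simp add: finite_imp_finite_nsets)
  then obtain q and h :: "_ \<Rightarrow> nat" where h: "h ` pats = {i. i < q}" "inj_on h pats"
    by (metis finite_imp_inj_to_nat_seg)
  obtain M where M: "partn_lst {..<M::nat} (replicate q (n + 2 * k)) (2 * k)"
    using ramsey_full by blast
  have "\<exists>X \<in> nsets {1..N} n. canonical k X r" if "N \<ge> M" for N r
  proof -
    define enum where "enum U i = sorted_list_of_set U ! i" for U :: "nat set" and i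
    \<comment> \<open>Recording index sets instead of subsets makes the patterns of different sets
      \<open>U\<close> comparable.\<close>
    define pat where "pat U = {(P, Q) \<in> nsets {..<2 * k} k \<times> nsets {..<2 * k} k.
      (enum U ` P, enum U ` Q) \<in> r}" for U
    have pat: "pat U \<in> pats" for U
      by (auto simp: pat_def pats_def)
    \<comment> \<open>Ramsey's theorem is stated for \<open>{..<N}\<close>, so the colouring of
      \<open>{1..N}\<close> is pulled back along \<open>Suc\<close>.\<close>
    have "(\<lambda>V. h (pat (Suc ` V))) \<in> nsets {..<N} (2 * k) \<rightarrow> {..<length (replicate q (n + 2 * k))}"
      using h(1) pat by auto
    moreover have "partn_lst {..<N} (replicate q (n + 2 * k)) (2 * k)"
      using M that by (rule partn_lst_greater_resource)
    ultimately obtain i H where i: "i < q" and "H \<in> nsets {..<N} (replicate q (n + 2 * k) ! i)"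
      and mono: "(\<lambda>V. h (pat (Suc ` V))) ` nsets H (2 * k) \<subseteq> {i}"
      unfolding partn_lst_def monochromatic_def by (metis length_replicate)
    then have H: "H \<in> nsets {..<N} (n + 2 * k)"
      by simp
    define Y where "Y = Suc ` H"
    have Y: "Y \<subseteq> {1..N}" "finite Y" "card Y = n + 2 * k"
      using H by (auto simp: Y_def nsets_def card_image)
    have hom: "pat U = pat U'" if "U \<in> nsets Y (2 * k)" "U' \<in> nsets Y (2 * k)" for U U'
    proof -
      have "\<exists>V \<in> nsets H (2 * k). U = Suc ` V" if "U \<in> nsets Y (2 * k)" for U
      proof -
        have "(\<lambda>V. Suc ` V) ` nsets H (2 * k) = nsets Y (2 * k)"
          unfolding Y_def by (intro bij_betw_imp_surj_on bij_betw_nsets inj_on_imp_bij_betw) simp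
        then show ?thesis using that by blast
      qed
      then have "h (pat U) = i" "h (pat U') = i"
        using that mono by blast+
      then show ?thesis
        using h(2) pat by (metis inj_onD)
    qed
    define X where "X = set (take n (sorted_list_of_set Y))"
    define Z where "Z = set (drop n (sorted_list_of_set Y))"
    have XZ: "X \<union> Z = Y"
      unfolding X_def Z_def using Y(2) by (metis append_take_drop_id set_append set_sorted_list_of_set)
    have less: "x < z" if "x \<in> X" "z \<in> Z" for x z
      using that strict_sorted_list_of_set[of Y] unfolding X_def Z_def
      by (metis append_take_drop_id sorted_wrt_append)
    have cX: "card X = n" and cZ: "card Z = 2 * k"
      using Y(3) unfolding X_def Z_def by (simp_all add: distinct_card)
    have "canonical k X r"
      unfolding canonical_def
    proof (intro allI impI monotone_onI)
      fix A B f S T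
      assume A: "A \<subseteq> X" and B: "B \<subseteq> X" and "bij_betw f A B" and f: "strict_mono_on A f"
        and S: "S \<in> nsets A k" and T: "T \<in> nsets A k" and ST: "(S, T) \<in> r"
      have fA: "f ` A = B"
        using \<open>bij_betw f A B\<close> by (rule bij_betw_imp_surj_on)
      have fin: "finite (S \<union> T)" and "card (S \<union> T) \<le> 2 * k"
        using S T card_Un_le[of S T] by (auto simp: nsets_def)
      \<comment> \<open>\<open>S \<union> T\<close> may have fewer than \<open>2 * k\<close>
        elements. The padding comes from \<open>Z\<close>, which lies above all of \<open>X\<close>,
        so \<open>f\<close> extended by the identity on \<open>W\<close> stays strictly
        increasing.\<close>
      then obtain W where W: "W \<subseteq> Z" "card W = 2 * k - card (S \<union> T)" "finite W"
        using cZ by (metis diff_le_self obtain_subset_with_card_n)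
      define U where "U = S \<union> T \<union> W"
      define F where "F x = (if x \<in> A then f x else x)" for x
      have SA: "S \<subseteq> A" and TA: "T \<subseteq> A" using S T by (auto simp: nsets_def)
      have disj: "X \<inter> Z = {}" using less by blast
      have Unsets: "U \<in> nsets Y (2 * k)"
      proof -
        have "(S \<union> T) \<inter> W = {}" using SA TA A W disj by blast
        then have "card U = 2 * k"
          using fin W \<open>card (S \<union> T) \<le> 2 * k\<close> by (simp add: U_def card_Un_disjoint)
        then show ?thesis
          using SA TA A W XZ fin by (auto simp: U_def nsets_def)
      qed
      have F: "strict_mono_on U F"
      proof (rule strict_mono_onI)
        fix x y assume xy: "x \<in> U" "y \<in> U" "x < y"
        then have mem: "x \<in> A \<or> x \<in> W" "y \<in> A \<or> y \<in> W"
          using SA TA by (auto simp: U_def)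
        have "\<not> (x \<in> W \<and> y \<in> A)"
          using xy less[of y x] W A by auto
        moreover have "f x < y" if "x \<in> A" "y \<in> W"
          using that less[of "f x" y] W fA B by auto
        moreover have "f x < f y" if "x \<in> A" "y \<in> A"
          using that f xy by (simp add: strict_mono_on_def)
        ultimately show "F x < F y"
          using mem xy W A disj by (auto simp: F_def)
      qed
      have FU: "F ` U \<in> nsets Y (2 * k)"
      proof -
        have "F ` U \<subseteq> Y"
          using SA TA A B W XZ fA by (auto simp: U_def F_def)
        then show ?thesis
          using Unsets F by (auto simp: nsets_def card_image strict_mono_on_imp_inj_on)
      qed
      have finU: "finite U" "card U = 2 * k" using Unsets by (auto simp: nsets_def)
      \<comment> \<open>An increasing map commutes with enumeration: the images of \<open>S\<close>
        and \<open>T\<close> under \<open>F\<close> have the same index sets in the image of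
        \<open>U\<close> as \<open>S\<close> and \<open>T\<close> have in \<open>U\<close>.
        Homogeneity then transfers the comparison.\<close>
      have enum: "enum (F ` U) i = F (enum U i)" if "i < 2 * k" for i
        using that finU F by (simp add: enum_def sorted_list_of_set_image)
      have "S \<in> nsets U k" "T \<in> nsets U k"
        using S T by (auto simp: U_def nsets_def)
      then obtain P Q where P: "P \<in> nsets {..<2 * k} k" "enum U ` P = S"
        and Q: "Q \<in> nsets {..<2 * k} k" "enum U ` Q = T"
        using nsets_of_enumeration[OF finU] unfolding enum_def by metis
      have "(P, Q) \<in> pat U"
        using P Q ST by (simp add: pat_def)
      then have "(P, Q) \<in> pat (F ` U)"
        using hom Unsets FU by blast
      then have "(enum (F ` U) ` P, enum (F ` U) ` Q) \<in> r"
        by (simp add: pat_def)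
      moreover have "enum (F ` U) ` P = F ` S"
        using P enum by (force simp: nsets_def image_image intro!: image_cong)
      moreover have "enum (F ` U) ` Q = F ` T"
        using Q enum by (force simp: nsets_def image_image intro!: image_cong)
      moreover have "F ` S = f ` S" "F ` T = f ` T"
        using SA TA by (auto simp: F_def intro!: image_cong)
      ultimately show "(f ` S, f ` T) \<in> r"
        by simp
    qed
    moreover have "X \<in> nsets {1..N} n"
      using cX XZ Y by (auto simp: nsets_def X_def)
    ultimately show ?thesis by blast
  qed
  then show ?thesis by blast
qed

section \<open>Orderings given by keys, and minimality of \<open>leeb_number\<close>\<close>

lemma strict_linear_order_on_key:
  fixes key :: "'a \<Rightarrow> 'b::linorder"
  assumes "inj_on key A"
  shows "strict_linear_order_on A {(S, T). key S < key T}"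
  using assms unfolding strict_linear_order_on_def
  by (auto simp: trans_def irrefl_def total_on_def inj_on_def) (metis linorder_neqE)

lemma leeb_numberD:
  assumes "leeb_number k n \<le> N" "strict_linear_order_on (nsets {1..N} k) r"
  shows "\<exists>X \<in> nsets {1..N} n. canonical k X r"
proof -
  have "\<exists>M::nat. \<forall>N\<ge>M. \<forall>r. strict_linear_order_on (nsets {1..N} k) r \<longrightarrow>
        (\<exists>X \<in> nsets {1..N} n. canonical k X r)"
    using leeb_theorem by blast
  from LeastI_ex[OF this] show ?thesis
    using assms unfolding leeb_number_def by blast
qed

text \<open>Both bounds are proved in this form: an injective key into a lexicographic product pulls
  back to an ordering, and it remains to exclude canonical sets.\<close>

lemma less_leeb_number:
  fixes key :: "nat set \<Rightarrow> 'b::linorder"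
  assumes "inj_on key (nsets {1..N} k)"
    and "\<And>X. X \<in> nsets {1..N} n \<Longrightarrow> \<not> canonical k X {(S, T). key S < key T}"
  shows "N < leeb_number k n"
  using leeb_numberD strict_linear_order_on_key[OF assms(1)] assms(2) by (meson not_le)

text \<open>Minimality yields a failure only for some \<open>N\<close> at or above the predecessor
  of the Leeb number. Every \<open>N\<close> from the Leeb number on succeeds, so the failure is at
  the predecessor itself.\<close>

lemma bad_ordering_below_leeb_number:
  assumes "0 < leeb_number k n"
  obtains r where "strict_linear_order_on (nsets {1..leeb_number k n - 1} k) r"
    and "\<forall>X \<in> nsets {1..leeb_number k n - 1} n. \<not> canonical k X r"
proof -
  let ?P = "\<lambda>N. \<forall>r. strict_linear_order_on (nsets {1..N} k) r \<longrightarrow>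
        (\<exists>X \<in> nsets {1..N} n. canonical k X r)"
  let ?L = "leeb_number k n"
  have "\<not> (\<forall>N \<ge> ?L - 1. ?P N)"
  proof -
    have "?L - 1 < (LEAST M. \<forall>N\<ge>M. ?P N)"
      using assms unfolding leeb_number_def by (rule diff_less[rotated]) simp
    then show ?thesis by (rule not_less_Least)
  qed
  then obtain N where "N \<ge> ?L - 1" "\<not> ?P N" by blast
  moreover have "?P N" if "N \<ge> ?L" for N
    using leeb_numberD that by blast
  ultimately have "\<not> ?P (?L - 1)"
    by (metis Suc_pred' assms le_antisym not_less_eq_eq)
  then show ?thesis using that by blast
qed

text \<open>Any ordering at all, here the one by \<open>set_encode\<close>, forces an
  \<open>n\<close>-subset to exist. This gives positivity of the Leeb number, so that subtracting 1
  later yields a true predecessor.\<close>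

lemma le_leeb_number:
  "n \<le> leeb_number k n"
proof (rule ccontr)
  assume "\<not> n \<le> leeb_number k n"
  then have "leeb_number k n < n" by simp
  have "inj_on set_encode (nsets {1..leeb_number k n} k)"
    by (rule inj_on_subset[OF inj_on_set_encode]) (auto simp: nsets_def)
  from leeb_numberD[OF order_refl strict_linear_order_on_key[OF this]]
  obtain X where "X \<in> nsets {1..leeb_number k n} n" by blast
  then have "n \<le> leeb_number k n"
    using card_mono[of "{1..leeb_number k n}" X] by (auto simp: nsets_def)
  then show False using \<open>leeb_number k n < n\<close> by simp
qed

text \<open>Counting predecessors turns an abstract ordering into numbers, which can be a component
  of a lexicographic key.\<close>

lemma linear_order_rank:
  assumes "finite A" "strict_linear_order_on A r"
  obtains rank :: "'a \<Rightarrow> nat"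
  where "\<And>x y. \<lbrakk>x \<in> A; y \<in> A\<rbrakk> \<Longrightarrow> (x, y) \<in> r \<longleftrightarrow> rank x < rank y"
proof -
  define rank where "rank x = card {u \<in> A. (u, x) \<in> r}" for x
  have less: "rank x < rank y" if "x \<in> A" "y \<in> A" "(x, y) \<in> r" for x y
    unfolding rank_def
  proof (rule psubset_card_mono)
    have "x \<notin> {u \<in> A. (u, x) \<in> r}" "x \<in> {u \<in> A. (u, y) \<in> r}"
      using assms(2) that by (auto simp: strict_linear_order_on_def irrefl_def)
    moreover have "{u \<in> A. (u, x) \<in> r} \<subseteq> {u \<in> A. (u, y) \<in> r}"
      using assms(2) that by (auto simp: strict_linear_order_on_def elim: transE)
    ultimately show "{u \<in> A. (u, x) \<in> r} \<subset> {u \<in> A. (u, y) \<in> r}" by blast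
  qed (use assms(1) in auto)
  have "(x, y) \<in> r" if "x \<in> A" "y \<in> A" "rank x < rank y" for x y
  proof (rule ccontr)
    assume "(x, y) \<notin> r"
    then have "(y, x) \<in> r"
      using assms(2) that by (auto simp: strict_linear_order_on_def total_on_def)
    with less[of y x] that show False by auto
  qed
  with less that show ?thesis by blast
qed

section \<open>Branching levels in the binary tree\<close>

text \<open>The leaves are \<open>1, \<dots>, 2^R\<close>, so the path to \<open>x\<close> is given by the binary digits of \<open>x - 1\<close>.\<close>

definition branch :: "nat \<Rightarrow> nat \<Rightarrow> nat" where
  "branch x y = (LEAST j. (x - 1) div 2 ^ j = (y - 1) div 2 ^ j)"

lemma branch_commute: "branch x y = branch y x"
  unfolding branch_def by metis

text \<open>Dividing further preserves equality, so the levels at which two paths agree form an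
  up-set, determined by its least element.\<close>

lemma branch_le_iff: "branch x y \<le> j \<longleftrightarrow> (x - 1) div 2 ^ j = (y - 1) div 2 ^ j"
proof -
  let ?P = "\<lambda>j. (x - 1) div 2 ^ j = (y - 1) div 2 ^ j"
  \<comment> \<open>At level \<open>x + y\<close> both quotients are 0, so the paths do
    meet.\<close>
  have "?P (x + y)"
    using less_exp[of "x + y"] by (metis add_lessD1 add.commute diff_le_self div_less le_less_trans)
  then have "?P (branch x y)"
    unfolding branch_def by (rule LeastI)
  moreover have "?P j" if "?P i" "i \<le> j" for i j
    using that by (metis div_mult2_eq le_add_diff_inverse power_add)
  ultimately show ?thesis
    unfolding branch_def using Least_le[of ?P] by blast
qed

lemma branch_pos:
  assumes "1 \<le> x" "x < y"
  shows "0 < branch x y"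
  using assms branch_le_iff[of x y 0] by auto

lemma branch_le:
  assumes "x \<le> 2 ^ R" "y \<le> 2 ^ R"
  shows "branch x y \<le> R"
proof -
  have "x - 1 < 2 ^ R" "y - 1 < 2 ^ R"
    using assms zero_less_power[of "2::nat" R] by linarith+
  then show ?thesis by (simp add: branch_le_iff)
qed

text \<open>Just below the meeting point the two ancestors are distinct siblings, and the smaller
  leaf lies under the left, even one.\<close>

lemma branch_digits:
  assumes "1 \<le> x" "x < y"
  obtains p q where "branch x y = Suc p" "(x - 1) div 2 ^ p = 2 * q" "(y - 1) div 2 ^ p = Suc (2 * q)"
proof -
  obtain p where p: "branch x y = Suc p"
    using branch_pos[OF assms] gr0_implies_Suc by blast
  let ?a = "(x - 1) div 2 ^ p" and ?b = "(y - 1) div 2 ^ p"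
  have "?a div 2 = ?b div 2"
    using branch_le_iff[of x y "Suc p"] p by (metis div_mult2_eq order_refl power_Suc2)
  moreover have "?a \<noteq> ?b"
    using branch_le_iff[of x y p] p by simp
  moreover have "?a \<le> ?b"
    using assms by (intro div_le_mono) simp
  moreover have "u = 2 * (u div 2) \<and> v = Suc (2 * (u div 2))"
    if "u div 2 = v div 2" "u \<noteq> v" "u \<le> v" for u v :: nat
    using that by presburger
  ultimately have "?a = 2 * (?a div 2)" "?b = Suc (2 * (?a div 2))"
    by blast+
  with p that show ?thesis by blast
qed

text \<open>Passing to ancestors preserves the order, so the ancestor of \<open>y\<close> lies
  between the other two. These agree exactly if both agree with it.\<close>

lemma branch_max:
  assumes "x < y" "y < z"
  shows "branch x z = max (branch x y) (branch y z)"
proof -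
  have "branch x z \<le> j \<longleftrightarrow> branch x y \<le> j \<and> branch y z \<le> j" for j
  proof -
    have "(x - 1) div 2 ^ j \<le> (y - 1) div 2 ^ j" "(y - 1) div 2 ^ j \<le> (z - 1) div 2 ^ j"
      using assms by (auto intro!: div_le_mono)
    then show ?thesis unfolding branch_le_iff by auto
  qed
  then have "branch x z \<le> j \<longleftrightarrow> max (branch x y) (branch y z) \<le> j" for j
    by simp
  then show ?thesis
    by (metis order_antisym order_refl)
qed

text \<open>Otherwise the ancestor of \<open>y\<close> just below the common level would be a right
  child because of \<open>x\<close> and a left child because of \<open>z\<close>.\<close>

lemma branch_neq:
  assumes "1 \<le> x" "x < y" "y < z"
  shows "branch x y \<noteq> branch y z"
proof
  assume eq: "branch x y = branch y z"
  obtain p q where 1: "branch x y = Suc p" "(y - 1) div 2 ^ p = Suc (2 * q)"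
    using assms(1,2) by (rule branch_digits)
  obtain p' q' where 2: "branch y z = Suc p'" "(y - 1) div 2 ^ p' = 2 * q'"
    by (rule branch_digits[of y z]) (use assms in auto)
  from 1 2 eq have "Suc (2 * q) = 2 * q'" by simp
  then show False by presburger
qed

text \<open>Xor with \<open>m\<close> swaps siblings at every level whose bit is set in
  \<open>m\<close>. Digit \<open>p\<close> is the highest in which the two leaves differ, so this
  bit alone decides whether their order is reversed.\<close>

lemma xor_less_iff:
  assumes "1 \<le> x" "x < y" "branch x y = Suc p"
  shows "xor (x - 1) m < xor (y - 1) m \<longleftrightarrow> p \<notin> set_decode m"
    and "xor (y - 1) m < xor (x - 1) m \<longleftrightarrow> p \<in> set_decode m"
proof -
  obtain q where q: "(x - 1) div 2 ^ p = 2 * q" "(y - 1) div 2 ^ p = Suc (2 * q)"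
    using branch_digits[OF assms(1,2)] assms(3) by (metis nat.inject)
  define a b where "a = xor (x - 1) m div 2 ^ p" and "b = xor (y - 1) m div 2 ^ p"
  have "a = xor (2 * q) (m div 2 ^ p)" "b = xor (Suc (2 * q)) (m div 2 ^ p)"
    unfolding a_def b_def using q by (simp_all flip: drop_bit_eq_div add: drop_bit_xor)
  moreover have "xor u v div 2 = xor (u div 2) (v div 2)" for u v :: nat
    using drop_bit_xor[of 1 u v] unfolding drop_bit_eq_div by simp
  ultimately have "a div 2 = b div 2" "even a \<longleftrightarrow> even (m div 2 ^ p)" "even b \<longleftrightarrow> odd (m div 2 ^ p)"
    by (simp_all add: even_xor_iff)
  moreover have "u < v" if "u div 2 = v div 2" "even u" "odd v" for u v :: nat
    using that by presburger
  ultimately have ab: "if even (m div 2 ^ p) then a < b else b < a"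
    by simp
  have "u < v" if "u div 2 ^ p < v div 2 ^ p" for u v :: nat
    using that by (meson div_le_mono not_le)
  then have "a < b \<Longrightarrow> xor (x - 1) m < xor (y - 1) m" "b < a \<Longrightarrow> xor (y - 1) m < xor (x - 1) m"
    unfolding a_def b_def by blast+
  then show "xor (x - 1) m < xor (y - 1) m \<longleftrightarrow> p \<notin> set_decode m"
    "xor (y - 1) m < xor (x - 1) m \<longleftrightarrow> p \<in> set_decode m"
    using ab by (auto simp: set_decode_def split: if_splits)
qed

lemma inj_on_xor: "inj_on (\<lambda>x. xor (x - 1) m) {1::nat..}"
proof (rule linorder_inj_onI)
  fix x y :: nat assume "x < y" "x \<in> {1..}"
  then have "1 \<le> x" "x < y" by simp_all
  moreover from this obtain p where "branch x y = Suc p"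
    by (rule branch_digits)
  ultimately show "xor (x - 1) m \<noteq> xor (y - 1) m"
    using xor_less_iff[of x y p m] by (cases "p \<in> set_decode m") simp_all
qed auto

section \<open>Combs\<close>

text \<open>
  The map \<open>g\<close> sends a level to a leaf of the comb, and \<open>z\<close> is the extreme leaf from which
  \<open>g d\<close> separates at level \<open>d\<close>. It is the first leaf if the levels increase, the last if they decrease.
\<close>

definition comb :: "nat set \<Rightarrow> nat \<Rightarrow> (nat \<Rightarrow> nat) \<Rightarrow> bool" where
  "comb D z g \<longleftrightarrow>
    (\<forall>d\<in>D. branch z (g d) = d) \<and> (\<forall>d\<in>D. \<forall>d'\<in>D. d < d' \<longrightarrow> branch (g d) (g d') = d') \<and>
    ((\<forall>d\<in>D. z < g d) \<and> strict_mono_on D g \<or> (\<forall>d\<in>D. g d < z) \<and> strict_antimono_on D g)"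

text \<open>By \<open>branch_max\<close> the branching level of two leaves is the maximum over the
  gaps between them, and here the last gap dominates. So each gap is represented by its right end,
  and \<open>z\<close> is the first leaf.\<close>

lemma comb_increasing:
  assumes e: "strict_mono_on {..m} e" and inc: "strict_mono_on {..<m} (\<lambda>i. branch (e i) (e (Suc i)))"
  obtains D z g where "comb D z g" "card D = m" "g ` D \<subseteq> e ` {..m}" "z \<in> e ` {..m}"
    "D = (\<lambda>i. branch (e i) (e (Suc i))) ` {..<m}"
proof -
  define \<delta> where "\<delta> i = branch (e i) (e (Suc i))" for i
  define g where "g d = e (Suc (inv_into {..<m} \<delta> d))" for d
  have less: "\<delta> i < \<delta> j" if "i < j" "j < m" for i j
    using inc that unfolding \<delta>_def by (auto simp: strict_mono_on_def)
  have eless: "e i < e j" if "i < j" "j \<le> m" for i j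
    using e that by (auto simp: strict_mono_on_def)
  have inj: "inj_on \<delta> {..<m}"
    using inc strict_mono_on_imp_inj_on unfolding \<delta>_def by blast
  have g: "g (\<delta> i) = e (Suc i)" if "i < m" for i
    using that by (simp add: g_def inv_into_f_f[OF inj])
  have branch: "branch (e i) (e (Suc j)) = \<delta> j" if "i \<le> j" "j < m" for i j
    using that
  proof (induction j rule: dec_induct)
    case base
    show ?case by (simp add: \<delta>_def)
  next
    case (step j)
    have "branch (e i) (e (Suc (Suc j))) = max (branch (e i) (e (Suc j))) (\<delta> (Suc j))"
      unfolding \<delta>_def using step by (intro branch_max eless) auto
    then show ?case using step less[of j "Suc j"] by simp
  qed
  have less_iff: "\<delta> i < \<delta> j \<longleftrightarrow> i < j" if "i < m" "j < m" for i j
    using that less by (metis linorder_neqE_nat less_asym less_irrefl)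
  have "comb (\<delta> ` {..<m}) (e 0) g"
    unfolding comb_def
    using branch eless by (auto simp: g less_iff strict_mono_on_def)
  moreover have "card (\<delta> ` {..<m}) = m"
    using inj by (simp add: card_image)
  moreover have "g ` \<delta> ` {..<m} \<subseteq> e ` {..m}" "e 0 \<in> e ` {..m}"
    using g by auto
  ultimately show ?thesis using that unfolding \<delta>_def by blast
qed

text \<open>The mirror image: the first gap dominates, each gap is represented by its left end, and
  \<open>z\<close> is the last leaf.\<close>

lemma comb_decreasing:
  assumes e: "strict_mono_on {..m} e" and dec: "strict_antimono_on {..<m} (\<lambda>i. branch (e i) (e (Suc i)))"
  obtains D z g where "comb D z g" "card D = m" "g ` D \<subseteq> e ` {..m}" "z \<in> e ` {..m}"
    "D = (\<lambda>i. branch (e i) (e (Suc i))) ` {..<m}"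
proof -
  define \<delta> where "\<delta> i = branch (e i) (e (Suc i))" for i
  define g where "g d = e (inv_into {..<m} \<delta> d)" for d
  have less: "\<delta> j < \<delta> i" if "i < j" "j < m" for i j
    using dec that unfolding \<delta>_def by (auto simp: monotone_on_def)
  have eless: "e i < e j" if "i < j" "j \<le> m" for i j
    using e that by (auto simp: strict_mono_on_def)
  have less_iff: "\<delta> j < \<delta> i \<longleftrightarrow> i < j" if "i < m" "j < m" for i j
    using that less by (metis linorder_neqE_nat less_asym less_irrefl)
  have inj: "inj_on \<delta> {..<m}"
    by (rule linorder_inj_onI) (use less in force)+
  have g: "g (\<delta> i) = e i" if "i < m" for i
    using that by (simp add: g_def inv_into_f_f[OF inj])
  have branch: "branch (e i) (e j) = \<delta> i" if "Suc i \<le> j" "j \<le> m" for i j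
    using that
  proof (induction j rule: dec_induct)
    case base
    show ?case by (simp add: \<delta>_def)
  next
    case (step j)
    have "branch (e i) (e (Suc j)) = max (branch (e i) (e j)) (\<delta> j)"
      unfolding \<delta>_def using step by (intro branch_max eless) auto
    then show ?case using step less[of i j] by simp
  qed
  have "comb (\<delta> ` {..<m}) (e m) g"
    unfolding comb_def
    using branch branch[THEN trans[OF branch_commute]] eless by (auto simp: g less_iff monotone_on_def)
  moreover have "card (\<delta> ` {..<m}) = m"
    using inj by (simp add: card_image)
  moreover have "g ` \<delta> ` {..<m} \<subseteq> e ` {..m}" "e m \<in> e ` {..m}"
    using g by auto
  ultimately show ?thesis using that unfolding \<delta>_def by blast
qed

lemma monotone_on_lessThanI:
  assumes "transp R" "\<And>i. Suc i < m \<Longrightarrow> R (f i) (f (Suc i))"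
  shows "monotone_on {..<m} (<) R f"
proof (rule monotone_onI)
  fix i j :: nat assume "i \<in> {..<m}" "j \<in> {..<m}" "i < j"
  then have "Suc i \<le> j" "j < m" by auto
  then show "R (f i) (f j)"
  proof (induction j rule: dec_induct)
    case base
    then show ?case by (rule assms(2))
  next
    case (step j)
    then show ?case
      using assms(2)[of j] by (auto intro: transpD[OF assms(1)])
  qed
qed

lemma comb_of_monotone_branches:
  assumes "strict_mono_on {..m} e" "1 \<le> e 0" "e m \<le> 2 ^ R"
    and "strict_mono_on {..<m} (\<lambda>i. branch (e i) (e (Suc i))) \<or>
      strict_antimono_on {..<m} (\<lambda>i. branch (e i) (e (Suc i)))"
  obtains D z g where "comb D z g" "D \<in> nsets {1..R} m" "g ` D \<subseteq> e ` {..m}" "z \<in> e ` {..m}"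
proof -
  obtain D z g where comb: "comb D z g" "card D = m" "g ` D \<subseteq> e ` {..m}" "z \<in> e ` {..m}"
    and D: "D = (\<lambda>i. branch (e i) (e (Suc i))) ` {..<m}"
    using assms(4) by (elim disjE comb_increasing[OF assms(1)] comb_decreasing[OF assms(1)])
  have "branch (e i) (e (Suc i)) \<in> {1..R}" if "i < m" for i
  proof -
    have "e 0 \<le> e i" "e i < e (Suc i)" "e (Suc i) \<le> e m"
      using that by (auto intro!: strict_mono_on_leD[OF assms(1)] strict_mono_onD[OF assms(1)])
    then show ?thesis
      using assms(2,3) branch_pos[of "e i" "e (Suc i)"] branch_le[of "e i" R "e (Suc i)"] by simp
  qed
  then have "D \<in> nsets {1..R} m"
    using comb(2) by (auto simp: D nsets_def)
  with comb that show ?thesis by blast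
qed

section \<open>Comparisons inside canonical sets\<close>

text \<open>The increasing map between two triples carries each comparison one way, and exchanging
  the triples gives the converse. The first equivalence will force a comb; the other two serve to
  read off the colouring.\<close>

lemma canonical_triple:
  assumes "canonical 2 X r" "a < b" "b < c" "{a, b, c} \<subseteq> X" "a' < b'" "b' < c'" "{a', b', c'} \<subseteq> X"
  shows "({a, b}, {b, c}) \<in> r \<longleftrightarrow> ({a', b'}, {b', c'}) \<in> r"
    and "({a, b}, {a, c}) \<in> r \<longleftrightarrow> ({a', b'}, {a', c'}) \<in> r"
    and "({a, c}, {b, c}) \<in> r \<longleftrightarrow> ({a', c'}, {b', c'}) \<in> r"
proof -
  have *: "(({a, b}, {b, c}) \<in> r \<longrightarrow> ({a', b'}, {b', c'}) \<in> r) \<and>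
    (({a, b}, {a, c}) \<in> r \<longrightarrow> ({a', b'}, {a', c'}) \<in> r) \<and>
    (({a, c}, {b, c}) \<in> r \<longrightarrow> ({a', c'}, {b', c'}) \<in> r)"
    if "a < b" "b < c" "{a, b, c} \<subseteq> X" "a' < b'" "b' < c'" "{a', b', c'} \<subseteq> X"
    for a b c a' b' c'
  proof -
    define f where "f x = (if x = a then a' else if x = b then b' else c')" for x
    have f: "f a = a'" "f b = b'" "f c = c'"
      using that by (auto simp: f_def)
    have "strict_mono_on {a, b, c} f"
      using that f by (auto simp: strict_mono_on_def)
    moreover have "f ` {a, b, c} \<subseteq> X"
      using that f by simp
    ultimately have "(f ` S, f ` T) \<in> r"
      if "S \<in> nsets {a, b, c} 2" "T \<in> nsets {a, b, c} 2" "(S, T) \<in> r" for S T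
      using canonical_image[OF assms(1) \<open>{a, b, c} \<subseteq> X\<close> _ _ _ that] by simp
    from this[of "{a, b}" "{b, c}"] this[of "{a, b}" "{a, c}"] this[of "{a, c}" "{b, c}"]
    show ?thesis
      using that by (auto simp: f)
  qed
  show "({a, b}, {b, c}) \<in> r \<longleftrightarrow> ({a', b'}, {b', c'}) \<in> r"
    "({a, b}, {a, c}) \<in> r \<longleftrightarrow> ({a', b'}, {a', c'}) \<in> r"
    "({a, c}, {b, c}) \<in> r \<longleftrightarrow> ({a', c'}, {b', c'}) \<in> r"
    using *[OF assms(2-7)] *[OF assms(5-7) assms(2-4)] by blast+
qed

lemma canonical_enumeration:
  fixes I :: "'b::linorder set"
  assumes "canonical k X r" "finite I" "strict_mono_on I e" "e ` I \<subseteq> X" "strict_mono_on I e'" "e' ` I \<subseteq> X"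
    and "S \<in> nsets I k" "T \<in> nsets I k"
  shows "(e ` S, e ` T) \<in> r \<longleftrightarrow> (e' ` S, e' ` T) \<in> r"
proof -
  have "(e' ` S, e' ` T) \<in> r"
    if e: "strict_mono_on I e" "e ` I \<subseteq> X" and e': "strict_mono_on I e'" "e' ` I \<subseteq> X"
      and ST: "(e ` S, e ` T) \<in> r" for e e' :: "'b \<Rightarrow> 'a"
  proof -
    define f where "f = e' \<circ> inv_into I e"
    have inj: "inj_on e I"
      using e(1) by (rule strict_mono_on_imp_inj_on)
    have f: "f (e i) = e' i" if "i \<in> I" for i
      using that inj by (simp add: f_def)
    have "e i < e j \<longleftrightarrow> i < j" if "i \<in> I" "j \<in> I" for i j
      using e(1) that by (rule strict_mono_on_less)
    then have "strict_mono_on (e ` I) f"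
      using e'(1) f by (auto simp: strict_mono_on_def)
    moreover have "f ` e ` I \<subseteq> X"
      using e'(2) f by auto
    moreover have "e ` S \<in> nsets (e ` I) k" "e ` T \<in> nsets (e ` I) k"
      using assms(7,8) inj by (auto simp: nsets_def card_image inj_on_subset)
    ultimately have "(f ` e ` S, f ` e ` T) \<in> r"
      using canonical_image[OF assms(1) e(2)] assms(2) ST by blast
    moreover have "f ` e ` P = e' ` P" if "P \<in> nsets I k" for P
      using that f by (force simp: nsets_def image_image intro!: image_cong)
    ultimately show ?thesis
      using assms(7,8) by simp
  qed
  then show ?thesis
    using assms(3-6) by blast
qed

lemma enumeration_of_nsets:
  fixes X :: "'a::linorder set"
  assumes "X \<in> nsets V n"
  obtains e where "strict_mono_on {..<n} e" "e ` {..<n} = X"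
proof -
  let ?e = "\<lambda>i. sorted_list_of_set X ! i"
  have X: "finite X" "card X = n" using assms by (auto simp: nsets_def)
  have "strict_mono_on {..<n} ?e"
    using X sorted_wrt_nth_less[OF strict_sorted_list_of_set[of X]]
    by (intro strict_mono_onI) auto
  moreover have "?e ` {..<n} = X"
    using bij_betw_nth[of "sorted_list_of_set X" "{..<n}" X] X
    by (simp add: bij_betw_imp_surj_on)
  ultimately show ?thesis using that by blast
qed

section \<open>Lower bound for pairs\<close>

lemma leeb_number_pairs:
  assumes "n \<ge> 2" "\<not> partn {1..R} (n - 1) 2 {..<2::nat}"
  shows "2 ^ R < leeb_number 2 n"
proof -
  obtain \<phi> where \<phi>: "\<phi> \<in> nsets {1..R} 2 \<rightarrow> {..<2::nat}"
    and no_mono: "\<And>\<xi> H. \<lbrakk>\<xi> < 2; H \<in> nsets {1..R} (n - 1)\<rbrakk> \<Longrightarrow> \<not> \<phi> ` nsets H 2 \<subseteq> {\<xi>}"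
    using assms(2) unfolding partn_def monochromatic_def by blast
  \<comment> \<open>Bit \<open>p\<close> governs level \<open>Suc p\<close>, as in
    \<open>xor_less_iff\<close>. The bound by \<open>R\<close> keeps the set finite for
    \<open>set_encode\<close>.\<close>
  define mask where "mask i = set_encode {p. Suc p \<le> R \<and> \<phi> {Suc p, i} = 1}" for i
  have "finite {p. Suc p \<le> R \<and> \<phi> {Suc p, i} = 1}" for i
    by (rule finite_subset[OF _ finite_lessThan[of R]]) auto
  then have mask: "set_decode (mask i) = {p. Suc p \<le> R \<and> \<phi> {Suc p, i} = 1}" for i
    unfolding mask_def by (simp add: set_encode_inverse)
  define key where "key S = (let b = branch (Min S) (Max S)
    in (b, xor (Min S - 1) (mask b), xor (Max S - 1) (mask b)))" for S
  have key: "key {x, y} = (branch x y, xor (x - 1) (mask (branch x y)), xor (y - 1) (mask (branch x y)))"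
    if "x < y" for x y
    using that by (simp add: key_def Let_def min_def max_def)
  have "inj_on key (nsets {1..2 ^ R} 2)"
  proof (rule inj_onI)
    fix S T assume ST: "S \<in> nsets {1..2 ^ R} 2" "T \<in> nsets {1..2 ^ R} 2" "key S = key T"
    have "\<exists>x y. 1 \<le> x \<and> x < y \<and> S = {x, y}" if "S \<in> nsets {1..2 ^ R} 2" for S :: "nat set"
    proof -
      from that obtain x y where "S = {x, y}" "1 \<le> x" "1 \<le> y" "x \<noteq> y"
        by (auto elim: nsets2_E)
      then show ?thesis by (metis insert_commute linorder_neqE_nat)
    qed
    then obtain x y u v where "1 \<le> x" "x < y" "S = {x, y}" "1 \<le> u" "u < v" "T = {u, v}"
      using ST by meson
    moreover from this ST(3) have "xor (x - 1) (mask (branch u v)) = xor (u - 1) (mask (branch u v))"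
      "xor (y - 1) (mask (branch u v)) = xor (v - 1) (mask (branch u v))"
      by (auto simp: key)
    ultimately show "S = T"
      using inj_onD[OF inj_on_xor, of x "mask (branch u v)" u]
        inj_onD[OF inj_on_xor, of y "mask (branch u v)" v] by simp
  qed
  moreover have "\<not> canonical 2 X {(S, T). key S < key T}" if X: "X \<in> nsets {1..2 ^ R} n" for X
  proof
    let ?r = "{(S, T). key S < key T}"
    assume can: "canonical 2 X ?r"
    obtain e where e: "strict_mono_on {..<n} e" "e ` {..<n} = X"
      using X by (rule enumeration_of_nsets)
    define \<delta> where "\<delta> i = branch (e i) (e (Suc i))" for i
    have eX: "e i \<in> X" if "i < n" for i using e(2) that by auto
    have X1: "1 \<le> x" "x \<le> 2 ^ R" if "x \<in> X" for x
      using X that by (auto simp: nsets_def)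
    have eless: "e i < e j" if "i < j" "j < n" for i j
      using e(1) that by (auto simp: strict_mono_on_def)
    have neq: "\<delta> i \<noteq> \<delta> (Suc i)" if "Suc (Suc i) < n" for i
      unfolding \<delta>_def using that by (intro branch_neq X1(1) eX eless) auto
    \<comment> \<open>Adjacent gaps have different branching levels, so the first component of the
      key decides this comparison; canonicity gives it the same outcome for all
      \<open>i\<close>.\<close>
    define P where "P i \<longleftrightarrow> ({e i, e (Suc i)}, {e (Suc i), e (Suc (Suc i))}) \<in> ?r" for i
    have P_const: "P i = P j" if "Suc (Suc i) < n" "Suc (Suc j) < n" for i j
      unfolding P_def using that by (intro canonical_triple(1)[OF can] eless) (auto intro: eX)
    have P_imp: "if P i then \<delta> i < \<delta> (Suc i) else \<delta> (Suc i) < \<delta> i" if "Suc (Suc i) < n" for i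
    proof -
      have "key {e i, e (Suc i)} = (\<delta> i, xor (e i - 1) (mask (\<delta> i)), xor (e (Suc i) - 1) (mask (\<delta> i)))"
        if "Suc i < n" for i
        unfolding \<delta>_def using that by (intro key eless) auto
      then show ?thesis
        using neq[OF that] that by (auto simp: P_def)
    qed
    have "(\<forall>i. Suc (Suc i) < n \<longrightarrow> \<delta> i < \<delta> (Suc i)) \<or> (\<forall>i. Suc (Suc i) < n \<longrightarrow> \<delta> (Suc i) < \<delta> i)"
      using P_const P_imp by metis
    then have "strict_mono_on {..<n - 1} \<delta> \<or> strict_antimono_on {..<n - 1} \<delta>"
      using monotone_on_lessThanI[of "(<)" "n - 1" \<delta>] monotone_on_lessThanI[of "(>)" "n - 1" \<delta>]
      by (auto simp: less_diff_conv)
    moreover have atMost: "{..n - 1} = {..<n}"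
      using assms(1) by auto
    moreover have "strict_mono_on {..n - 1} e" "1 \<le> e 0" "e (n - 1) \<le> 2 ^ R"
      using e(1) X1 eX assms(1) atMost by auto
    ultimately obtain D z g where comb: "comb D z g" and D: "D \<in> nsets {1..R} (n - 1)"
      and gX: "g ` D \<subseteq> X" and zX: "z \<in> X"
      unfolding \<delta>_def using comb_of_monotone_branches e(2) by (metis (no_types, lifting))
    have D_range: "1 \<le> d" "d \<le> R" if "d \<in> D" for d
      using D that by (auto simp: nsets_def)
    have mask_iff: "d - 1 \<in> set_decode (mask d') \<longleftrightarrow> \<phi> {d, d'} = 1" if "d \<in> D" for d d'
      using D_range[OF that] by (simp add: mask)
    have bz: "branch z (g d) = d" if "d \<in> D" for d
      using comb that by (simp add: comb_def)
    have bg: "branch (g d) (g d') = d'" if "d \<in> D" "d' \<in> D" "d < d'" for d d'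
      using comb that by (simp add: comb_def)
    from comb consider (inc) "\<forall>d\<in>D. z < g d" "strict_mono_on D g"
      | (dec) "\<forall>d\<in>D. g d < z" "strict_antimono_on D g"
      unfolding comb_def by blast
    then have "\<exists>b. \<forall>d\<in>D. \<forall>d'\<in>D. d < d' \<longrightarrow> (\<phi> {d, d'} = 1) = b"
    proof cases
      case inc
      have less: "z < g d" "g d < g d'" "{z, g d, g d'} \<subseteq> X" if "d \<in> D" "d' \<in> D" "d < d'" for d d'
        using inc that gX zX by (auto simp: strict_mono_on_def)
      \<comment> \<open>Both pairs branch at level \<open>d'\<close> and share their right leaf, so
        \<open>z\<close> is compared with \<open>g d\<close> under \<open>mask d'\<close>. These two
        separate at level \<open>d\<close>, hence their order is reversed iff \<open>{d, d'}\<close>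
        has colour 1.\<close>
      have "\<phi> {d, d'} = 1 \<longleftrightarrow> ({z, g d'}, {g d, g d'}) \<notin> ?r" if d: "d \<in> D" "d' \<in> D" "d < d'" for d d'
      proof -
        have "branch z (g d') = d'" "branch (g d) (g d') = d'" "branch z (g d) = Suc (d - 1)"
          using bz bg d D_range(1)[OF d(1)] by auto
        moreover have "1 \<le> z" "z < g d" "z < g d'" "g d < g d'"
          using less[OF d] X1(1) by auto
        ultimately show ?thesis
          using mask_iff[OF d(1), of d'] xor_less_iff(1)[of z "g d" "d - 1" "mask d'"]
          by (simp add: key)
      qed
      with canonical_triple(3)[OF can less less] show ?thesis by metis
    next
      case dec
      have less: "g d' < g d" "g d < z" "{g d', g d, z} \<subseteq> X" if "d \<in> D" "d' \<in> D" "d < d'" for d d'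
        using dec that gX zX by (auto simp: monotone_on_def)
      \<comment> \<open>Now the shared leaf is the left one: the second components tie, and the
        third compare \<open>g d\<close> with \<open>z\<close>.\<close>
      have "\<phi> {d, d'} = 1 \<longleftrightarrow> ({g d', g d}, {g d', z}) \<notin> ?r" if d: "d \<in> D" "d' \<in> D" "d < d'" for d d'
      proof -
        have "branch (g d') (g d) = d'" "branch (g d') z = d'" "branch (g d) z = Suc (d - 1)"
          using bz bg d D_range(1)[OF d(1)]
          by (auto simp: branch_commute[of _ z] branch_commute[of "g d'" "g d"])
        moreover have "1 \<le> g d" "g d' < g d" "g d < z" "g d' < z"
          using less[OF d] X1(1) by auto
        ultimately show ?thesis
          using mask_iff[OF d(1), of d'] xor_less_iff(1)[of "g d" z "d - 1" "mask d'"]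
          by (simp add: key)
      qed
      with canonical_triple(2)[OF can less less] show ?thesis by metis
    qed
    then obtain b where b: "\<forall>d\<in>D. \<forall>d'\<in>D. d < d' \<longrightarrow> (\<phi> {d, d'} = 1) = b" ..
    have "\<phi> S = of_bool b" if "S \<in> nsets D 2" for S
    proof -
      from that obtain x y where "S = {x, y}" "x \<in> D" "y \<in> D" "x \<noteq> y"
        by (rule nsets2_E)
      then obtain d d' where S: "S = {d, d'}" "d \<in> D" "d' \<in> D" "d < d'"
        by (metis insert_commute linorder_neqE_nat)
      then have "S \<in> nsets {1..R} 2"
        using D by (auto simp: nsets_def)
      then have "\<phi> S < 2" using \<phi> by blast
      moreover have "(\<phi> S = 1) = b" using b S by simp
      ultimately show ?thesis by (cases b) auto
    qed
    then have "\<phi> ` nsets D 2 \<subseteq> {of_bool b}" by auto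
    with no_mono[OF _ D, of "of_bool b"] show False by (cases b) simp_all
  qed
  ultimately show ?thesis by (rule less_leeb_number)
qed

section \<open>Stepping up from \<open>k - 1\<close> to \<open>k\<close>\<close>

definition branches :: "nat set \<Rightarrow> nat set" where
  "branches K = {branch x y | x y. x \<in> K \<and> y \<in> K \<and> x \<noteq> y}"

text \<open>Three elements suffice: they reveal the direction of a comb, and on successive blocks
  they report every pair of adjacent gaps.\<close>

definition rising :: "nat set \<Rightarrow> bool" where
  "rising K \<longleftrightarrow> (let xs = sorted_list_of_set K in branch (xs ! 0) (xs ! 1) < branch (xs ! 1) (xs ! 2))"

lemma rising_enumeration:
  assumes "strict_mono_on {i..<i + k} e" "3 \<le> k"
  shows "rising (e ` {i..<i + k}) \<longleftrightarrow> branch (e i) (e (Suc i)) < branch (e (Suc i)) (e (Suc (Suc i)))"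
  using assms(2) unfolding rising_def
  by (simp add: sorted_list_of_set_image[OF _ assms(1)] Let_def)

text \<open>A leaf \<open>g d\<close> meets \<open>z\<close> at level \<open>d\<close>, and two
  leaves of the comb other than \<open>z\<close> meet at the larger of their levels, so no new level
  arises.\<close>

lemma branches_comb:
  assumes "comb D z g" "S \<subseteq> D"
  shows "branches (insert z (g ` S)) = S"
proof
  have z: "branch z (g d) = d" "branch (g d) z = d" "g d \<noteq> z" if "d \<in> S" for d
    using assms that branch_commute[of z "g d"] by (auto simp: comb_def)
  show "S \<subseteq> branches (insert z (g ` S))"
  proof
    fix d assume "d \<in> S"
    then have "d = branch z (g d) \<and> z \<in> insert z (g ` S) \<and> g d \<in> insert z (g ` S) \<and> z \<noteq> g d"
      using z by force
    then show "d \<in> branches (insert z (g ` S))"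
      unfolding branches_def by blast
  qed
  have g: "branch (g d) (g d') \<in> S" if "d \<in> S" "d' \<in> S" "d \<noteq> d'" for d d'
  proof -
    have "branch (g (min d d')) (g (max d d')) = max d d'"
      using assms that unfolding comb_def min_def max_def by (auto simp: subset_iff)
    then have "branch (g d) (g d') = max d d'"
      using branch_commute[of "g d" "g d'"] by (auto simp: min_def max_def split: if_splits)
    then show ?thesis using that by (simp add: max_def)
  qed
  show "branches (insert z (g ` S)) \<subseteq> S"
  proof
    fix t assume "t \<in> branches (insert z (g ` S))"
    then obtain x y where t: "t = branch x y" "x \<noteq> y" "x = z \<or> x \<in> g ` S" "y = z \<or> y \<in> g ` S"
      unfolding branches_def by blast
    then consider d where "x = z" "y = g d" "d \<in> S" | d where "x = g d" "y = z" "d \<in> S"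
      | d d' where "x = g d" "y = g d'" "d \<in> S" "d' \<in> S" "d \<noteq> d'"
      by blast
    then show "t \<in> S"
      by cases (use t(1) z g in simp_all)
  qed
qed

lemma inj_on_comb:
  assumes "comb D z g"
  shows "inj_on g D"
  using assms unfolding comb_def by (metis inj_onI)

text \<open>Branching levels grow from left to right if \<open>z\<close> is the least leaf and
  shrink if it is the greatest. The answer does not depend on \<open>S\<close>, so
  \<open>rising\<close> never separates such sets and the next component of the key decides.\<close>

lemma rising_comb:
  assumes comb: "comb D z g" and "S \<subseteq> D" "finite S" "2 \<le> card S"
  shows "rising (insert z (g ` S)) \<longleftrightarrow> (\<forall>d\<in>D. z < g d)"
proof -
  define K where "K = insert z (g ` S)"
  let ?x = "\<lambda>i. sorted_list_of_set K ! i"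
  have "z \<notin> g ` S"
    using comb assms(2) by (auto simp: comb_def)
  then have card: "card K = Suc (card S)" and fin: "finite K"
    unfolding K_def using inj_on_subset[OF inj_on_comb[OF comb] assms(2)] assms(3) by (simp_all add: card_image)
  have elem: "?x i = z \<or> (\<exists>d\<in>D. ?x i = g d)" if "i < 3" for i
  proof -
    have "?x i \<in> K"
      using nth_mem[of i "sorted_list_of_set K"] that card fin assms(4) by simp
    then show ?thesis using assms(2) by (auto simp: K_def)
  qed
  have less: "?x 0 < ?x 1" "?x 1 < ?x 2"
    using sorted_wrt_nth_less[OF strict_sorted_list_of_set[of K]] card fin assms(4) by simp_all
  have bz: "branch z (g d) = d" "branch (g d) z = d" if "d \<in> D" for d
    using comb that branch_commute[of z "g d"] by (auto simp: comb_def)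
  have bg: "branch (g d) (g d') = d'" "branch (g d') (g d) = d'" if "d \<in> D" "d' \<in> D" "d < d'" for d d'
    using comb that branch_commute[of "g d" "g d'"] by (auto simp: comb_def)
  from comb consider (inc) "\<forall>d\<in>D. z < g d" "strict_mono_on D g"
    | (dec) "\<forall>d\<in>D. g d < z" "strict_antimono_on D g"
    unfolding comb_def by blast
  then show ?thesis
  proof cases
    case inc
    have "?x 1 \<noteq> z" "?x 2 \<noteq> z"
      using elem[of 0] elem[of 1] less inc by force+
    then obtain d1 d2 where d: "d1 \<in> D" "d2 \<in> D" "?x 1 = g d1" "?x 2 = g d2"
      using elem[of 1] elem[of 2] by auto
    have iff: "g d < g d' \<longleftrightarrow> d < d'" if "d \<in> D" "d' \<in> D" for d d'
      using inc(2) that by (rule strict_mono_on_less)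
    have "d1 < d2" using d less iff by metis
    moreover have "branch (?x 0) (?x 1) = d1"
    proof -
      consider "?x 0 = z" | d0 where "d0 \<in> D" "?x 0 = g d0"
        using elem[of 0] by auto
      then show ?thesis
        by cases (use d less(1) in \<open>simp_all add: bz bg iff\<close>)
    qed
    ultimately show ?thesis
      using d inc by (simp add: rising_def Let_def bg flip: K_def)
  next
    case dec
    have "?x 0 \<noteq> z" "?x 1 \<noteq> z"
      using elem[of 1] elem[of 2] less dec by force+
    then obtain d0 d1 where d: "d0 \<in> D" "d1 \<in> D" "?x 0 = g d0" "?x 1 = g d1"
      using elem[of 0] elem[of 1] by auto
    have iff: "g d < g d' \<longleftrightarrow> d' < d" if "d \<in> D" "d' \<in> D" for d d'
    proof -
      have "d < d' \<Longrightarrow> g d' < g d" "d' < d \<Longrightarrow> g d < g d'"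
        using dec(2) that by (auto simp: monotone_on_def)
      then show ?thesis by (metis less_asym less_irrefl linorder_neqE_nat)
    qed
    have "d1 < d0" using d less iff by metis
    moreover have "branch (?x 1) (?x 2) = d1"
    proof -
      consider "?x 2 = z" | d2 where "d2 \<in> D" "?x 2 = g d2"
        using elem[of 2] by auto
      then show ?thesis
        by cases (use d less(2) in \<open>simp_all add: bz bg iff\<close>)
    qed
    moreover have "\<not> (\<forall>d\<in>D. z < g d)"
      using dec(1) d(1) by (auto dest: less_asym)
    ultimately show ?thesis
      using d by (simp add: rising_def Let_def bg flip: K_def)
  qed
qed

text \<open>Adding \<open>z\<close> turns \<open>(k - 1)\<close>-sets of levels into
  \<open>k\<close>-subsets of \<open>X\<close>, so the relation induced on the levels inherits
  canonicity.\<close>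

lemma canonical_comb:
  assumes can: "canonical k X r" and comb: "comb D z g" and X: "g ` D \<subseteq> X" "z \<in> X"
    and lift: "\<And>S T. \<lbrakk>S \<in> nsets D (k - 1); T \<in> nsets D (k - 1)\<rbrakk> \<Longrightarrow>
      (insert z (g ` S), insert z (g ` T)) \<in> r \<longleftrightarrow> (S, T) \<in> r'"
    and "0 < k"
  shows "canonical (k - 1) D r'"
  unfolding canonical_def
proof (intro allI impI monotone_onI)
  fix A B f S T
  assume A: "A \<subseteq> D" and B: "B \<subseteq> D" and fin: "finite A" and bij: "bij_betw f A B"
    and f: "strict_mono_on A f"
    and S: "S \<in> nsets A (k - 1)" and T: "T \<in> nsets A (k - 1)" and ST: "(S, T) \<in> r'"
  have fA: "f ` A = B"
    using bij by (rule bij_betw_imp_surj_on)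
  have inj: "inj_on g D"
    using comb by (rule inj_on_comb)
  have gz: "g d \<noteq> z" if "d \<in> D" for d
    using comb that by (auto simp: comb_def)
  \<comment> \<open>The map of levels is conjugated by \<open>g\<close>, and \<open>z\<close> is
    fixed. If \<open>g\<close> is decreasing, the order is reversed twice, so \<open>F\<close> is
    increasing in either case.\<close>
  define F where "F x = (if x = z then z else g (f (inv_into D g x)))" for x
  have Fz: "F z = z" by (simp add: F_def)
  have Fg: "F (g d) = g (f d)" if "d \<in> A" for d
    using that A inj gz by (auto simp: F_def)
  have fD: "f d \<in> D" if "d \<in> A" for d
    using that fA B by auto
  have "g d < g d' \<longleftrightarrow> g (f d) < g (f d')" if "d \<in> A" "d' \<in> A" for d d'
  proof -
    have D: "d \<in> D" "d' \<in> D" "f d \<in> D" "f d' \<in> D"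
      using that A fD by auto
    have "d < d' \<longleftrightarrow> f d < f d'" "d' < d \<longleftrightarrow> f d' < f d"
      using strict_mono_on_less[OF f] that by blast+
    moreover have "strict_mono_on D g \<or> strict_antimono_on D g"
      using comb by (auto simp: comb_def)
    ultimately show ?thesis
      using D by (auto simp: monotone_on_def) (metis less_asym less_irrefl linorder_neqE_nat)+
  qed
  moreover have "z < g d \<longleftrightarrow> z < g (f d)" "g d < z \<longleftrightarrow> g (f d) < z" if "d \<in> A" for d
  proof -
    have "d \<in> D" "f d \<in> D" using that A fD by auto
    then show "z < g d \<longleftrightarrow> z < g (f d)" "g d < z \<longleftrightarrow> g (f d) < z"
      using comb by (auto simp: comb_def dest: less_asym)
  qed
  ultimately have F: "strict_mono_on (insert z (g ` A)) F"
    by (auto simp: strict_mono_on_def Fz Fg)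
  have sub: "insert z (g ` A) \<subseteq> X" "F ` insert z (g ` A) \<subseteq> X"
    using X A fD by (auto simp: Fz Fg)
  have mem: "insert z (g ` P) \<in> nsets (insert z (g ` A)) k" if "P \<in> nsets A (k - 1)" for P
  proof -
    have P: "P \<subseteq> A" "finite P" "card P = k - 1" using that by (auto simp: nsets_def)
    then have "card (g ` P) = k - 1" "z \<notin> g ` P"
      using A inj_on_subset[OF inj] gz by (auto simp: card_image)
    then show ?thesis using P \<open>0 < k\<close> by (auto simp: nsets_def)
  qed
  have image: "F ` insert z (g ` P) = insert z (g ` f ` P)" if "P \<in> nsets A (k - 1)" for P
    using that by (auto simp: nsets_def Fz Fg image_iff subset_iff intro!: bexI)
  have nD: "P \<in> nsets D (k - 1)" "f ` P \<in> nsets D (k - 1)" if "P \<in> nsets A (k - 1)" for P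
    using that A fD strict_mono_on_imp_inj_on[OF f]
    by (auto simp: nsets_def card_image inj_on_subset)
  have "(insert z (g ` S), insert z (g ` T)) \<in> r"
    using lift nD S T ST by blast
  then have "(F ` insert z (g ` S), F ` insert z (g ` T)) \<in> r"
    by (intro canonical_image[OF can sub(1) _ F sub(2) mem[OF S] mem[OF T]]) (use fin in simp)
  then show "(f ` S, f ` T) \<in> r'"
    unfolding image[OF S] image[OF T] using lift nD S T by blast
qed

lemma leeb_number_step:
  assumes "0 < n" "3 \<le> k"
  shows "2 ^ (leeb_number (k - 1) n - 1) < leeb_number k (4 * n + k)"
proof -
  define M where "M = leeb_number (k - 1) n - 1"
  have pos: "0 < leeb_number (k - 1) n"
    using le_leeb_number[of n "k - 1"] assms(1) by simp
  obtain r\<^sub>0 where r\<^sub>0: "strict_linear_order_on (nsets {1..M} (k - 1)) r\<^sub>0"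
    and bad: "\<forall>D \<in> nsets {1..M} n. \<not> canonical (k - 1) D r\<^sub>0"
    by (rule bad_ordering_below_leeb_number[OF pos, folded M_def])
  obtain rank :: "nat set \<Rightarrow> nat" where rank: "\<And>S T. \<lbrakk>S \<in> nsets {1..M} (k - 1); T \<in> nsets {1..M} (k - 1)\<rbrakk>
      \<Longrightarrow> (S, T) \<in> r\<^sub>0 \<longleftrightarrow> rank S < rank T"
    using linear_order_rank[OF _ r\<^sub>0] by (auto simp: finite_imp_finite_nsets)
  \<comment> \<open>\<open>rank\<close> is specified only on \<open>(k - 1)\<close>-subsets of
    \<open>{1..M}\<close>, which suffices for the sets taken from a comb. The last component makes
    the key injective on finite sets.\<close>
  define key where "key K = (rising K, rank (branches K), set_encode K)" for K
  let ?r = "{(S, T). key S < key T}"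
  have "inj_on key (nsets {1..2 ^ M} k)"
    by (auto simp: inj_on_def key_def nsets_def set_encode_eq)
  moreover have "\<not> canonical k X ?r" if X: "X \<in> nsets {1..2 ^ M} (4 * n + k)" for X
  proof
    assume can: "canonical k X ?r"
    obtain e where e: "strict_mono_on {..<4 * n + k} e" "e ` {..<4 * n + k} = X"
      using X by (rule enumeration_of_nsets)
    define \<delta> where "\<delta> i = branch (e i) (e (Suc i))" for i
    have eX: "e i \<in> X" if "i < 4 * n + k" for i using e(2) that by auto
    have X1: "1 \<le> x" "x \<le> 2 ^ M" if "x \<in> X" for x
      using X that by (auto simp: nsets_def)
    have eless: "e i < e j" if "i < j" "j < 4 * n + k" for i j
      using e(1) that by (auto simp: strict_mono_on_def)
    define W where "W i = e ` {i..<i + k}" for i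
    have rising_W: "rising (W i) \<longleftrightarrow> \<delta> i < \<delta> (Suc i)" if "i \<le> 4 * n" for i
      unfolding W_def \<delta>_def using that assms(2)
      by (intro rising_enumeration strict_mono_onI eless) auto
    \<comment> \<open>Adjacent blocks are the first and the last \<open>k\<close> of
      \<open>k + 1\<close> consecutive elements, and canonicity allows these to be shifted by
      \<open>i\<close>.\<close>
    have step: "(W i, W (Suc i)) \<in> ?r \<longleftrightarrow> (W 0, W 1) \<in> ?r" if "i < 4 * n" for i
    proof -
      have "((\<lambda>j. e (i + j)) ` {0..<k}, (\<lambda>j. e (i + j)) ` {1..<Suc k}) \<in> ?r \<longleftrightarrow>
        (e ` {0..<k}, e ` {1..<Suc k}) \<in> ?r"
        using that by (intro canonical_enumeration[OF can, where I = "{..k}"])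
          (auto simp: nsets_def intro!: strict_mono_onI eless eX)
      moreover have "(\<lambda>j. e (i + j)) ` {a..<b} = e ` {i + a..<i + b}" for a b
        using image_image[of e "(+) i" "{a..<b}"] by (simp add: add.commute)
      ultimately show ?thesis by (simp add: W_def)
    qed
    have chain: "monotone_on {..<4 * n} (\<le>) R (\<lambda>i. rising (W i))"
      if "\<And>i. i < 4 * n \<Longrightarrow> R (rising (W i)) (rising (W (Suc i)))" "reflp R" "transp R" for R
    proof (rule monotone_onI)
      fix i j assume "i \<in> {..<4 * n}" "j \<in> {..<4 * n}" "i \<le> j"
      from this(3,2) show "R (rising (W i)) (rising (W j))"
      proof (induction j rule: dec_induct)
        case base
        show ?case using \<open>reflp R\<close> by (rule reflpD)
      next
        case (step j)
        then show ?case using that(1)[of j] by (auto intro: transpD[OF \<open>transp R\<close>])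
      qed
    qed
    \<comment> \<open>The value of a monotone truth-valued sequence at block \<open>n\<close>
      settles either the \<open>n\<close> blocks before it or the \<open>n\<close> blocks starting
      with it, so \<open>s\<close> is \<open>0\<close> or \<open>n\<close>.\<close>
    have "\<exists>s b. s + n \<le> 4 * n \<and> (\<forall>i<n. rising (W (s + i)) = b)"
    proof (cases "(W 0, W 1) \<in> ?r")
      case True
      then have "rising (W i) \<le> rising (W (Suc i))" if "i < 4 * n" for i
        using step[OF that] by (auto simp: key_def)
      then have mono: "monotone_on {..<4 * n} (\<le>) (\<le>) (\<lambda>i. rising (W i))"
        by (rule chain) (auto simp: reflp_def transp_def)
      show ?thesis
      proof (cases "rising (W n)")
        case True
        have "rising (W (n + i))" if "i < n" for i
          using True monotone_onD[OF mono, of n "n + i"] that by simp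
        then show ?thesis by (intro exI[of _ n] exI[of _ True]) auto
      next
        case False
        have "\<not> rising (W (0 + i))" if "i < n" for i
          using False monotone_onD[OF mono, of i n] that by auto
        then show ?thesis by (intro exI[of _ 0] exI[of _ False]) auto
      qed
    next
      case False
      then have "rising (W (Suc i)) \<le> rising (W i)" if "i < 4 * n" for i
        using step[OF that] by (auto simp: key_def)
      then have mono: "monotone_on {..<4 * n} (\<le>) (\<ge>) (\<lambda>i. rising (W i))"
        by (rule chain) (auto simp: reflp_def transp_def)
      show ?thesis
      proof (cases "rising (W n)")
        case True
        have "rising (W (0 + i))" if "i < n" for i
          using True monotone_onD[OF mono, of i n] that by simp
        then show ?thesis by (intro exI[of _ 0] exI[of _ True]) auto
      next
        case False
        have "\<not> rising (W (n + i))" if "i < n" for i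
          using False monotone_onD[OF mono, of n "n + i"] that by auto
        then show ?thesis by (intro exI[of _ n] exI[of _ False]) auto
      qed
    qed
    then obtain s b where s: "s + n \<le> 4 * n" and b: "\<And>i. i < n \<Longrightarrow> rising (W (s + i)) = b"
      by auto
    have neq: "\<delta> i \<noteq> \<delta> (Suc i)" if "i < 4 * n" for i
      unfolding \<delta>_def using that assms(2) by (intro branch_neq X1(1) eX eless) auto
    have mono: "strict_mono_on {..<n} (\<lambda>i. \<delta> (s + i)) \<or> strict_antimono_on {..<n} (\<lambda>i. \<delta> (s + i))"
    proof (cases b)
      case True
      then have "\<delta> (s + i) < \<delta> (s + Suc i)" if "Suc i < n" for i
        using b[of i] rising_W[of "s + i"] that s by simp
      then show ?thesis by (intro disjI1 monotone_on_lessThanI) auto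
    next
      case False
      \<comment> \<open>Not rising means weakly falling; \<open>neq\<close> makes it strict.\<close>
      then have "\<delta> (s + i) > \<delta> (s + Suc i)" if "Suc i < n" for i
        using b[of i] rising_W[of "s + i"] neq[of "s + i"] that s by simp
      then show ?thesis by (intro disjI2 monotone_on_lessThanI) auto
    qed
    have "strict_mono_on {..n} (\<lambda>i. e (s + i))"
      using s assms(2) by (intro strict_mono_onI eless) auto
    moreover have "1 \<le> e (s + 0)" "e (s + n) \<le> 2 ^ M"
      using s assms(2) X1(1)[OF eX, of s] X1(2)[OF eX, of "s + n"] by auto
    ultimately obtain D z g where comb: "comb D z g" and D: "D \<in> nsets {1..M} n"
      and "g ` D \<subseteq> (\<lambda>i. e (s + i)) ` {..n}" "z \<in> (\<lambda>i. e (s + i)) ` {..n}"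
      using comb_of_monotone_branches[of n "\<lambda>i. e (s + i)" M] mono by (auto simp: \<delta>_def)
    moreover have "(\<lambda>i. e (s + i)) ` {..n} \<subseteq> X"
      using s assms(2) by (auto intro!: eX)
    ultimately have gX: "g ` D \<subseteq> X" and zX: "z \<in> X" by auto
    have "canonical (k - 1) D r\<^sub>0"
    proof (rule canonical_comb[OF can comb gX zX])
      fix S T assume S: "S \<in> nsets D (k - 1)" and T: "T \<in> nsets D (k - 1)"
      have M: "S \<in> nsets {1..M} (k - 1)" "T \<in> nsets {1..M} (k - 1)"
        using S T D by (auto simp: nsets_def)
      have rising: "rising (insert z (g ` P)) \<longleftrightarrow> (\<forall>d\<in>D. z < g d)" if "P \<in> nsets D (k - 1)" for P
        using that assms(2) by (intro rising_comb[OF comb]) (auto simp: nsets_def)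
      have branches: "branches (insert z (g ` P)) = P" if "P \<in> nsets D (k - 1)" for P
        using that by (intro branches_comb[OF comb]) (auto simp: nsets_def)
      \<comment> \<open>By totality of the bad ordering, equal ranks force equal sets. So the
        tie-breaker \<open>set_encode\<close> is reached only if \<open>S\<close> and
        \<open>T\<close> coincide, when neither side holds.\<close>
      have "S = T" if "rank S = rank T"
        using that M r\<^sub>0 rank[OF M] rank[OF M(2,1)]
        by (auto simp: strict_linear_order_on_def total_on_def)
      then show "(insert z (g ` S), insert z (g ` T)) \<in> ?r \<longleftrightarrow> (S, T) \<in> r\<^sub>0"
        using rank[OF M] rising[OF S] rising[OF T] branches[OF S] branches[OF T]
        by (auto simp: key_def)
    qed (use assms in simp)
    with bad D show False by blast
  qed
  ultimately have "2 ^ M < leeb_number k (4 * n + k)"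
    by (rule less_leeb_number)
  then show ?thesis by (simp add: M_def)
qed

theorem theorem1p3:
  shows "(\<forall>n R :: nat. n \<ge> 4 \<longrightarrow> R \<ge> 1 \<longrightarrow> \<not> partn {1..R} (n - 1) 2 {..<2::nat} \<longrightarrow>
            leeb_number 2 n > 2 ^ R) \<and>
         (\<forall>n k :: nat. n \<ge> k \<longrightarrow> k \<ge> 3 \<longrightarrow>
            leeb_number k (4 * n + k) > 2 ^ (leeb_number (k - 1) n - 1))"
proof (intro conjI allI impI)
  fix n R :: nat
  assume "n \<ge> 4" "\<not> partn {1..R} (n - 1) 2 {..<2::nat}"
  then show "leeb_number 2 n > 2 ^ R"
    by (intro leeb_number_pairs) linarith
next
  fix n k :: nat
  assume "n \<ge> k" "k \<ge> 3"
  then show "leeb_number k (4 * n + k) > 2 ^ (leeb_number (k - 1) n - 1)"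
    by (intro leeb_number_step) linarith
qed

end
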